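(* For every rollout $\tau$ with influence-dependency data and trajectory advantage $\hat A_\tau$ as defined in the context, all routing multipliers are positive, i.e. $w_i^{+}>0$ and $w_i^{-}>0$ for all $1\le i\le T$, and every token advantage has the same sign as $\hat A_\tau$: $\operatorname{sign}(A_{i,\ell})=\operatorname{sign}(\hat A_\tau)$ for every action $a_i$ and every token $\ell$ of $a_i$ (where $\operatorname{sign}(0)=0$).
   Context: Rollout. A rollout $\tau$ consists of $T\ge 1$ actions $a_1,\dots,a_T$; action $a_i$ has $L_i\ge 1$ tokens, and $L=\sum_{i=1}^T L_i$. Its trajectory advantage is the real number $\hat A_\tau=(R_\tau-\mu_{\mathcal G})/(\sigma_{\mathcal G}+\varepsilon)$, where $R_\tau\in\mathbb R$ is the terminal reward of $\tau$, and $\mu_{\mathcal G},\sigma_{\mathcal G}$ are the mean and standard deviation of the terminal rewards over a finite group $\mathcal G$ of $K$ rollouts containing $\tau$. Throughout $\varepsilon=10^{-6}$. Influence-dependency data. Edge sets $E^{+},E^{-}\subseteq\{(i,j):1\le i<j\le T\}$ (support-use and failed-use edges), error indicators $e_i\in\{0,1\}$, and direct-input counts $u_i^{\mathrm{dir}}\in\mathbb Z_{\ge 0}$ for $1\le i\le T$. Put $d_i^{+}=|\{j:(i,j)\in E^{+}\}|$, $d_i^{-}=|\{j:(i,j)\in E^{-}\}|$, $d_i^{\mathrm{in}}=u_i^{\mathrm{dir}}+|\{k:(k,i)\in E^{+}\}|$. It is assumed that $d_i^{-}>0$ implies $e_i=1$. Graph features. $\phi_i^{+}=\log(1+d_i^{+}+d_i^{\mathrm{in}})$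 and $\phi_i^{-}=\log\bigl(1+e_i(1+d_i^{-}+d_i^{\mathrm{in}})\bigr)$. Normalization. Fix a clipping constant $c>0$, with $\mathrm{clip}(z,-c,c)=\max(-c,\min(z,c))$. For $\phi\in\mathbb R_{\ge 0}^T$ let $\bar\phi=\frac1L\sum_i L_i\phi_i$, $\sigma_\phi^2=\frac1L\sum_i L_i(\phi_i-\bar\phi)^2$ (with $\sigma_\phi\ge 0$), $z_i=(\phi_i-\bar\phi)/(\sigma_\phi+\varepsilon)$, and $$m_i=\frac{\exp(\mathrm{clip}(z_i,-c,c))}{\frac1L\sum_j L_j\exp(\mathrm{clip}(z_j,-c,c))}.$$ Write $m_i^{+}$ and $m_i^{-}$ for the values obtained from $\phi=\phi^{+}$ and $\phi=\phi^{-}$ respectively. Routing weights. Fix $\beta_{+}\ge 0$ and let $\psi_i^{-}=\phi_i^{-}-\bar\phi^{-}$ with $\bar\phi^{-}=\frac1L\sum_i L_i\phi_i^{-}$. Define $$w_i^{+}=\frac{L\,m_i^{+}\exp(-\beta_{+}\psi_i^{-})}{\sum_j L_j\,m_j^{+}\exp(-\beta_{+}\psi_j^{-})},\qquad w_i^{-}=m_i^{-}.$$ Routed advantage. Every token $\ell$ of action $a_i$ receives $A_{i,\ell}=\hat A_\tau\,w_i$, where $w_i=w_i^{+}$ if $\hat A_\tau>0$ and $w_i=w_i^{-}$ if $\hat A_\tau<0$; if $\hat A_\tau=0$ then $A_{i,\ell}=0$. *)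

theory Defs
  imports Complex_Main "HOL-Library.Multiset"
begin

(* Actions are numbered 1, ..., num_actions; values of the fields below outside
   this range carry no meaning and are never used. *)

record rollout =
  num_actions :: nat
  num_tokens :: "nat \<Rightarrow> nat"
  reward :: real

record influence_data =
  support_edges :: "(nat \<times> nat) set"
  failed_edges :: "(nat \<times> nat) set"
  err :: "nat \<Rightarrow> nat"
  direct_inputs :: "nat \<Rightarrow> nat"

abbreviation actions :: "rollout \<Rightarrow> nat set" where
  "actions \<tau> \<equiv> {1..num_actions \<tau>}"

definition valid_rollout :: "rollout \<Rightarrow> bool" where
  "valid_rollout \<tau> \<longleftrightarrow> num_actions \<tau> \<ge> 1 \<and> (\<forall>i\<in>actions \<tau>. num_tokens \<tau> i \<ge> 1)"

definition total_tokens :: "rollout \<Rightarrow> nat" where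
  "total_tokens \<tau> = (\<Sum>i\<in>actions \<tau>. num_tokens \<tau> i)"

definition eps :: real where
  "eps = 1 / 10 ^ 6"


(* A group is a multiset, so that the same rollout may be sampled more than once.
   The standard deviation is the population one (divisor K, not K - 1). *)

definition group_mean :: "rollout multiset \<Rightarrow> real" where
  "group_mean G = (\<Sum>\<rho>\<in>#G. reward \<rho>) / real (size G)"

definition group_std :: "rollout multiset \<Rightarrow> real" where
  "group_std G = sqrt ((\<Sum>\<rho>\<in>#G. (reward \<rho> - group_mean G)\<^sup>2) / real (size G))"

definition trajectory_advantage :: "rollout multiset \<Rightarrow> rollout \<Rightarrow> real" where
  "trajectory_advantage G \<tau> = (reward \<tau> - group_mean G) / (group_std G + eps)"


definition support_out :: "influence_data \<Rightarrow> nat \<Rightarrow> nat" where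
  "support_out D i = card {j. (i, j) \<in> support_edges D}"

definition failed_out :: "influence_data \<Rightarrow> nat \<Rightarrow> nat" where
  "failed_out D i = card {j. (i, j) \<in> failed_edges D}"

definition in_count :: "influence_data \<Rightarrow> nat \<Rightarrow> nat" where
  "in_count D i = direct_inputs D i + card {k. (k, i) \<in> support_edges D}"

definition valid_influence_data :: "rollout \<Rightarrow> influence_data \<Rightarrow> bool" where
  "valid_influence_data \<tau> D \<longleftrightarrow>
     support_edges D \<subseteq> {(i, j). 1 \<le> i \<and> i < j \<and> j \<le> num_actions \<tau>} \<and>
     failed_edges D \<subseteq> {(i, j). 1 \<le> i \<and> i < j \<and> j \<le> num_actions \<tau>} \<and>
     (\<forall>i\<in>actions \<tau>. err D i \<in> {0, 1}) \<and>
     (\<forall>i\<in>actions \<tau>. failed_out D i > 0 \<longrightarrow> err D i = 1)"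

definition phi_plus :: "influence_data \<Rightarrow> nat \<Rightarrow> real" where
  "phi_plus D i = ln (1 + real (support_out D i) + real (in_count D i))"

definition phi_minus :: "influence_data \<Rightarrow> nat \<Rightarrow> real" where
  "phi_minus D i =
     ln (1 + real (err D i) * (1 + real (failed_out D i) + real (in_count D i)))"


definition clip :: "real \<Rightarrow> real \<Rightarrow> real \<Rightarrow> real" where
  "clip z lo hi = max lo (min z hi)"

definition token_mean :: "rollout \<Rightarrow> (nat \<Rightarrow> real) \<Rightarrow> real" where
  "token_mean \<tau> \<phi> =
     1 / real (total_tokens \<tau>) * (\<Sum>i\<in>actions \<tau>. real (num_tokens \<tau> i) * \<phi> i)"

definition token_std :: "rollout \<Rightarrow> (nat \<Rightarrow> real) \<Rightarrow> real" where
  "token_std \<tau> \<phi> = sqrt (token_mean \<tau> (\<lambda>i. (\<phi> i - token_mean \<tau> \<phi>)\<^sup>2))"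

definition zscore :: "rollout \<Rightarrow> (nat \<Rightarrow> real) \<Rightarrow> nat \<Rightarrow> real" where
  "zscore \<tau> \<phi> i = (\<phi> i - token_mean \<tau> \<phi>) / (token_std \<tau> \<phi> + eps)"

definition multiplier :: "rollout \<Rightarrow> real \<Rightarrow> (nat \<Rightarrow> real) \<Rightarrow> nat \<Rightarrow> real" where
  "multiplier \<tau> c \<phi> i =
     exp (clip (zscore \<tau> \<phi> i) (- c) c)
       / token_mean \<tau> (\<lambda>j. exp (clip (zscore \<tau> \<phi> j) (- c) c))"

definition psi_minus :: "rollout \<Rightarrow> influence_data \<Rightarrow> nat \<Rightarrow> real" where
  "psi_minus \<tau> D i = phi_minus D i - token_mean \<tau> (phi_minus D)"

definition w_plus :: "rollout \<Rightarrow> influence_data \<Rightarrow> real \<Rightarrow> real \<Rightarrow> nat \<Rightarrow> real" where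
  "w_plus \<tau> D c \<beta> i =
     real (total_tokens \<tau>) * multiplier \<tau> c (phi_plus D) i * exp (- \<beta> * psi_minus \<tau> D i)
       / (\<Sum>j\<in>actions \<tau>. real (num_tokens \<tau> j) * multiplier \<tau> c (phi_plus D) j
                             * exp (- \<beta> * psi_minus \<tau> D j))"

definition w_minus :: "rollout \<Rightarrow> influence_data \<Rightarrow> real \<Rightarrow> nat \<Rightarrow> real" where
  "w_minus \<tau> D c i = multiplier \<tau> c (phi_minus D) i"

(* The last argument is the token index; all tokens of an action share one value. *)
definition token_advantage ::
  "rollout multiset \<Rightarrow> rollout \<Rightarrow> influence_data \<Rightarrow> real \<Rightarrow> real \<Rightarrow> nat \<Rightarrow> nat \<Rightarrow> real" where
  "token_advantage G \<tau> D c \<beta> i l =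
     (let A = trajectory_advantage G \<tau> in
      if A > 0 then A * w_plus \<tau> D c \<beta> i
      else if A < 0 then A * w_minus \<tau> D c i
      else 0)"

end

theory Submission
  imports Defs
begin

text \<open>Each routing weight is a quotient of positive reals. Its numerator is built from
  exponentials, and its denominator is a token-weighted sum or mean of exponentials over the
  actions, which is positive because there is at least one action and each has at least one token
  (\<open>token_sum_pos\<close>). This gives \<open>multiplier_pos\<close>, hence
  \<open>w_plus_pos\<close> and \<open>w_minus_pos\<close>. A token advantage is then the trajectory
  advantage times a positive factor, or zero when that advantage is zero, so its sign is
  unchanged.\<close>

lemma token_sum_pos:
  assumes "valid_rollout \<tau>" and "\<And>i. i \<in> actions \<tau> \<Longrightarrow> f i > (0::real)"
  shows "(\<Sum>i\<in>actions \<tau>. real (num_tokens \<tau> i) * f i) > 0"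
proof (rule sum_pos)
  show "actions \<tau> \<noteq> {}"
    using assms(1) by (simp add: valid_rollout_def)
  show "real (num_tokens \<tau> i) * f i > 0" if "i \<in> actions \<tau>" for i
    using assms(1) assms(2)[OF that] that
    by (intro mult_pos_pos) (auto simp: valid_rollout_def Suc_le_eq)
qed simp

lemma total_tokens_pos:
  assumes "valid_rollout \<tau>"
  shows "total_tokens \<tau> > 0"
  \<comment> \<open>With constant weight 1 the weighted sum is the token count itself.\<close>
  using token_sum_pos[OF assms, of "\<lambda>_. 1"] by (simp add: total_tokens_def flip: of_nat_sum)

lemma token_mean_pos:
  assumes "valid_rollout \<tau>" and "\<And>i. i \<in> actions \<tau> \<Longrightarrow> f i > 0"
  shows "token_mean \<tau> f > 0"
  unfolding token_mean_def
  using token_sum_pos[OF assms] total_tokens_pos[OF assms(1)] by simp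

text \<open>Clipping only changes the exponent, so numerator and averaged terms remain values of
  \<open>exp\<close>.\<close>

lemma multiplier_pos:
  assumes "valid_rollout \<tau>"
  shows "multiplier \<tau> c \<phi> i > 0"
  unfolding multiplier_def by (intro divide_pos_pos token_mean_pos assms) simp_all

lemma w_plus_pos:
  assumes "valid_rollout \<tau>"
  shows "w_plus \<tau> D c \<beta> i > 0"
  \<comment> \<open>Reassociating gives each summand of the denominator the shape
    \<open>real (num_tokens \<tau> j) * f j\<close> that \<open>token_sum_pos\<close>
    expects.\<close>
  unfolding w_plus_def mult.assoc
  by (intro divide_pos_pos token_sum_pos mult_pos_pos multiplier_pos assms)
    (simp_all add: total_tokens_pos[OF assms])

lemma w_minus_pos:
  assumes "valid_rollout \<tau>"
  shows "w_minus \<tau> D c i > 0"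
  unfolding w_minus_def by (rule multiplier_pos[OF assms])

lemma sgn_token_advantage:
  assumes "valid_rollout \<tau>"
  shows "sgn (token_advantage G \<tau> D c \<beta> i l) = sgn (trajectory_advantage G \<tau>)"
  using w_plus_pos[OF assms, of D c \<beta> i] w_minus_pos[OF assms, of D c i]
  by (auto simp: token_advantage_def Let_def sgn_mult)

theorem proposition3:
  fixes G :: "rollout multiset" and \<tau> :: rollout and D :: influence_data
    and c \<beta> :: real
  assumes "\<forall>\<rho>\<in>#G. valid_rollout \<rho>"
    and "\<tau> \<in># G"
    and "valid_influence_data \<tau> D"
    and "c > 0"
    and "\<beta> \<ge> 0"
  shows "(\<forall>i\<in>actions \<tau>. w_plus \<tau> D c \<beta> i > 0 \<and> w_minus \<tau> D c i > 0) \<and>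
         (\<forall>i\<in>actions \<tau>. \<forall>l\<in>{1..num_tokens \<tau> i}.
            sgn (token_advantage G \<tau> D c \<beta> i l) = sgn (trajectory_advantage G \<tau>))"
  \<comment> \<open>Membership of \<open>\<tau>\<close> in the group supplies
    \<open>valid_rollout \<tau>\<close>.\<close>
  using assms(1,2) by (simp add: w_plus_pos w_minus_pos sgn_token_advantage)

end
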